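(* Let $X$ be a metric space and let $F\subseteq X$ be non-empty, with closure $\overline F$ in $X$. Then \[ \dim_{\mathrm L}F=\dim_{\mathrm L}\overline F . \]
   Context: For a non-empty subset $F$ of a metric space and $r>0$, $N_r(F)$ denotes the smallest number of open sets of diameter at most $r$ needed to cover $F$ (possibly $\infty$). $B(x,R)$ is the closed ball of centre $x$ and radius $R$. The lower dimension is \[ \dim_{\mathrm L}F=\sup\Big\{\alpha:\ \exists\, C,\rho>0 \text{ such that for all } 0<r<R\leq\rho,\ \inf_{x\in F}N_r(B(x,R)\cap F)\geq C (R/r)^{\alpha}\Big\}\in[0,\infty]. \] *)

theory Defs
  imports "HOL-Analysis.Analysis"
begin

(* Smallest number of open sets of diameter at most r covering A; the infimum of the
   empty family is infinity, the value when there is no finite cover. Boundedness is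
   required explicitly because the library's diameter is only meaningful on bounded sets. *)
definition covering_number :: "real \<Rightarrow> 'a::metric_space set \<Rightarrow> enat" where
  "covering_number r A =
     (INF \<U> \<in> {\<U>. finite \<U> \<and> A \<subseteq> \<Union>\<U> \<and> (\<forall>U\<in>\<U>. open U \<and> bounded U \<and> diameter U \<le> r)}.
        enat (card \<U>))"

(* The exponent ranges over all reals; alpha = 0 is always admissible when F is non-empty,
   so the supremum then lies in [0, infinity]. *)
definition lower_dim :: "'a::metric_space set \<Rightarrow> ereal" where
  "lower_dim F =
     Sup (ereal ` {\<alpha>. \<exists>C>0. \<exists>\<rho>>0. \<forall>r R. 0 < r \<and> r < R \<and> R \<le> \<rho> \<longrightarrow>
       ereal_of_enat (INF x\<in>F. covering_number r (cball x R \<inter> F)) \<ge> ereal (C * (R / r) powr \<alpha>)})"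

end

theory Submission
  imports Defs
begin

text \<open>
  A ball \<open>B(x, R)\<close> of one of the two sets \<open>F\<close>, \<open>closure F\<close> can be compared with a ball of half the
  radius in the other one, at the cost of at most doubling the scale \<open>r\<close>.

  If \<open>x \<in> closure F\<close>, some \<open>y \<in> F\<close> lies within \<open>R/2\<close> of \<open>x\<close>, and then
  \<open>B(y, R/2) \<inter> F \<subseteq> B(x, R) \<inter> closure F\<close>. Conversely, if \<open>x \<in> F\<close> and finitely many open sets cover
  \<open>B(x, R) \<inter> F\<close>, then their closures cover \<open>B(x, R/2) \<inter> closure F\<close>, since closure commutes with finite
  unions. The closures need not be open; the open \<open>r/2\<close>-neighbourhood of a covering set
  contains its closure and raises the diameter from
  at most \<open>r\<close> to at most \<open>2r\<close>. This is lemma \<open>covering_number_half_ball_closure_le\<close>.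

  Passing from \<open>(r, R)\<close> to \<open>(2r, R/2)\<close> divides the ratio \<open>R/r\<close> by four, so it changes a power
  \<open>(R/r)\<^sup>\<alpha>\<close> by a constant factor only; when \<open>R/r \<le> 4\<close> the new radius does not exceed the
  new scale, so nothing is known about the smaller ball, but then the power itself is bounded and the
  trivial lower bound \<open>1\<close> for the covering number is enough. Hence the two sets have the same admissible exponents
  (lemma \<open>lower_dim_le_of_covering_comparison\<close>, applied in both directions).
\<close>

lemma le_ereal_of_enat_INF_iff:
  "c \<le> ereal_of_enat (INF x\<in>A. f x) \<longleftrightarrow> (\<forall>x\<in>A. c \<le> ereal_of_enat (f x))"
proof
  assume "c \<le> ereal_of_enat (INF x\<in>A. f x)"
  then show "\<forall>x\<in>A. c \<le> ereal_of_enat (f x)"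
    by (meson INF_lower ereal_of_enat_le_iff order_trans)
next
  assume *: "\<forall>x\<in>A. c \<le> ereal_of_enat (f x)"
  show "c \<le> ereal_of_enat (INF x\<in>A. f x)"
  proof (cases "A = {}")
    case True
    then show ?thesis by (simp add: top_enat_def)
  next
    case False
    \<comment> \<open>\<^typ>\<open>enat\<close> is well-ordered, so the infimum is attained.\<close>
    then have "(INF x\<in>A. f x) \<in> f ` A"
      by (auto simp: Inf_enat_def intro: LeastI)
    with * show ?thesis by auto
  qed
qed

lemma covering_number_le_transfer:
  assumes "\<And>\<U>. \<lbrakk>finite \<U>; B \<subseteq> \<Union>\<U>; \<And>U. U \<in> \<U> \<Longrightarrow> open U \<and> bounded U \<and> diameter U \<le> s\<rbrakk> \<Longrightarrow>
    \<exists>\<V>. finite \<V> \<and> A \<subseteq> \<Union>\<V> \<and> (\<forall>V\<in>\<V>. open V \<and> bounded V \<and> diameter V \<le> r) \<and> card \<V> \<le> card \<U>"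
  shows "covering_number r A \<le> covering_number s B"
  unfolding covering_number_def
proof (rule INF_mono)
  fix \<U> assume "\<U> \<in> {\<U>. finite \<U> \<and> B \<subseteq> \<Union>\<U> \<and> (\<forall>U\<in>\<U>. open U \<and> bounded U \<and> diameter U \<le> s)}"
  then show "\<exists>\<V>\<in>{\<V>. finite \<V> \<and> A \<subseteq> \<Union>\<V> \<and> (\<forall>V\<in>\<V>. open V \<and> bounded V \<and> diameter V \<le> r)}.
      enat (card \<V>) \<le> enat (card \<U>)"
    using assms[of \<U>] by auto
qed

lemma covering_number_mono:
  assumes "A \<subseteq> B" and "s \<le> r"
  shows "covering_number r A \<le> covering_number s B"
proof (rule covering_number_le_transfer)
  fix \<U> :: "'a set set"
  assume "finite \<U>" "B \<subseteq> \<Union>\<U>" "\<And>U. U \<in> \<U> \<Longrightarrow> open U \<and> bounded U \<and> diameter U \<le> s"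
  with assms show "\<exists>\<V>. finite \<V> \<and> A \<subseteq> \<Union>\<V> \<and> (\<forall>V\<in>\<V>. open V \<and> bounded V \<and> diameter V \<le> r) \<and>
      card \<V> \<le> card \<U>"
    by (intro exI[of _ \<U>]) force
qed

lemma covering_number_ge_1:
  assumes "A \<noteq> {}"
  shows "1 \<le> covering_number r A"
  unfolding covering_number_def
proof (rule INF_greatest)
  fix \<U> assume "\<U> \<in> {\<U>. finite \<U> \<and> A \<subseteq> \<Union>\<U> \<and> (\<forall>U\<in>\<U>. open U \<and> bounded U \<and> diameter U \<le> r)}"
  with assms have "0 < card \<U>" by (auto simp: card_gt_0_iff)
  then show "1 \<le> enat (card \<U>)" by (simp add: one_enat_def)
qed

lemma dist_thickening_le:
  fixes U :: "'a::metric_space set"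
  assumes "bounded U" and "y \<in> (\<Union>u\<in>U. ball u e)" and "z \<in> (\<Union>u\<in>U. ball u e)"
  shows "dist y z \<le> diameter U + 2 * e"
proof -
  obtain u v where u: "u \<in> U" "dist u y < e" and v: "v \<in> U" "dist v z < e"
    using assms by auto
  have "dist y z \<le> dist u y + dist u v + dist v z"
    by metric
  with u v diameter_bounded_bound[OF assms(1) u(1) v(1)] show ?thesis by linarith
qed

lemma bounded_thickening:
  fixes U :: "'a::metric_space set"
  assumes "bounded U"
  shows "bounded (\<Union>u\<in>U. ball u e)"
  using dist_thickening_le[OF assms] unfolding bounded_two_points by blast

lemma diameter_thickening_le:
  fixes U :: "'a::metric_space set"
  assumes "bounded U" and "0 \<le> e"
  shows "diameter (\<Union>u\<in>U. ball u e) \<le> diameter U + 2 * e"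
proof -
  have "0 \<le> diameter U + 2 * e"
    using assms diameter_ge_0[of U] by auto
  define T where "T = (\<Union>u\<in>U. ball u e)"
  have "dist y z \<le> diameter U + 2 * e" if "y \<in> T" "z \<in> T" for y z
    using that unfolding T_def by (rule dist_thickening_le[OF assms(1)])
  with \<open>0 \<le> diameter U + 2 * e\<close> have "diameter T \<le> diameter U + 2 * e"
    unfolding diameter_def[of T] by (auto intro!: cSUP_least)
  then show ?thesis by (simp only: T_def)
qed

text \<open>
  Halving the radius leaves room to approximate: a point of \<open>closure F\<close> in the smaller ball is a limit
  of points of \<open>F\<close> in the larger one, so it lies within \<open>r/2\<close> of a set of any cover of
  \<open>cball x R \<inter> F\<close>.
\<close>
lemma covering_number_half_ball_closure_le:
  fixes F :: "'a::metric_space set"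
  assumes "0 < r" and "0 < R"
  shows "covering_number (2 * r) (cball x (R / 2) \<inter> closure F) \<le> covering_number r (cball x R \<inter> F)"
proof (rule covering_number_le_transfer)
  fix \<U> :: "'a set set"
  assume fin: "finite \<U>" and cover: "cball x R \<inter> F \<subseteq> \<Union>\<U>"
    and \<U>: "\<And>U. U \<in> \<U> \<Longrightarrow> open U \<and> bounded U \<and> diameter U \<le> r"
  define T where "T U = (\<Union>u\<in>U. ball u (r / 2))" for U :: "'a set"
  have "cball x (R / 2) \<inter> closure F \<subseteq> \<Union>(T ` \<U>)"
  proof
    fix y assume y: "y \<in> cball x (R / 2) \<inter> closure F"
    have "0 < min (R / 2) (r / 2)" using assms by simp
    with y obtain z where z: "z \<in> F" "dist z y < R / 2" "dist z y < r / 2"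
      by (auto simp: closure_approachable dest!: spec[of _ "min (R / 2) (r / 2)"])
    have "dist x z \<le> R"
      using y z dist_triangle[of x z y] by (simp add: dist_commute)
    with z cover obtain U where "U \<in> \<U>" "z \<in> U" by auto
    with z show "y \<in> \<Union>(T ` \<U>)" by (auto simp: T_def)
  qed
  moreover have "open (T U) \<and> bounded (T U) \<and> diameter (T U) \<le> 2 * r" if "U \<in> \<U>" for U
    using \<U>[OF that] assms(1) diameter_thickening_le[of U "r / 2"]
      bounded_thickening[of U "r / 2"]
    unfolding T_def by auto
  ultimately show "\<exists>\<V>. finite \<V> \<and> cball x (R / 2) \<inter> closure F \<subseteq> \<Union>\<V> \<and>
      (\<forall>V\<in>\<V>. open V \<and> bounded V \<and> diameter V \<le> 2 * r) \<and> card \<V> \<le> card \<U>"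
    using fin by (intro exI[of _ "T ` \<U>"]) (auto intro: card_image_le)
qed

text \<open>
  A loss of constant factors in both the scale and the radius does not affect admissible exponents.
  The factor \<open>2\<close> in each is the one that the closure argument produces.
\<close>
lemma lower_dim_le_of_covering_comparison:
  fixes F G :: "'a::metric_space set"
  assumes compare: "\<And>x r R. \<lbrakk>x \<in> G; 0 < r; 0 < R\<rbrakk> \<Longrightarrow>
    \<exists>y\<in>F. covering_number (2 * r) (cball y (R / 2) \<inter> F) \<le> covering_number r (cball x R \<inter> G)"
  shows "lower_dim F \<le> lower_dim G"
  unfolding lower_dim_def
proof (rule Sup_subset_mono, rule image_mono, rule subsetI, unfold mem_Collect_eq)
  fix \<alpha> :: real
  assume "\<exists>C>0. \<exists>\<rho>>0. \<forall>r R. 0 < r \<and> r < R \<and> R \<le> \<rho> \<longrightarrow>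
    ereal (C * (R / r) powr \<alpha>) \<le> ereal_of_enat (INF x\<in>F. covering_number r (cball x R \<inter> F))"
  then obtain C \<rho> where "0 < C" "0 < \<rho>" and
    F: "\<And>r R y. \<lbrakk>0 < r; r < R; R \<le> \<rho>; y \<in> F\<rbrakk> \<Longrightarrow>
      ereal (C * (R / r) powr \<alpha>) \<le> ereal_of_enat (covering_number r (cball y R \<inter> F))"
    unfolding le_ereal_of_enat_INF_iff by blast
  \<comment> \<open>The first entry pays for dividing \<open>R / r\<close> by four, the second one makes the bound at most \<open>1\<close>
    for \<open>R / r \<le> 4\<close>; the absolute value is there because \<open>\<alpha>\<close> may be negative.\<close>
  define C' where "C' = min (C * 4 powr - \<alpha>) (4 powr - \<bar>\<alpha>\<bar>)"
  have "0 < C'" using \<open>0 < C\<close> by (simp add: C'_def)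
  have "ereal (C' * (R / r) powr \<alpha>) \<le> ereal_of_enat (covering_number r (cball x R \<inter> G))"
    if rR: "0 < r" "r < R" "R \<le> \<rho>" "x \<in> G" for r R x
  proof (cases "2 * r < R / 2")
    case True
    obtain y where y: "y \<in> F"
      "covering_number (2 * r) (cball y (R / 2) \<inter> F) \<le> covering_number r (cball x R \<inter> G)"
      using compare[of x r R] rR by auto
    have "C' * (R / r) powr \<alpha> \<le> C * 4 powr - \<alpha> * (R / r) powr \<alpha>"
      by (intro mult_right_mono) (simp_all add: C'_def)
    also have "\<dots> = C * (R / 2 / (2 * r)) powr \<alpha>"
      using rR powr_divide[of "R / r" 4 \<alpha>] by (simp add: powr_minus divide_simps mult_ac)
    finally have "ereal (C' * (R / r) powr \<alpha>) \<le> ereal (C * (R / 2 / (2 * r)) powr \<alpha>)"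
      by simp
    also have "\<dots> \<le> ereal_of_enat (covering_number (2 * r) (cball y (R / 2) \<inter> F))"
      using F[of "2 * r" "R / 2" y] True rR y(1) by simp
    also have "\<dots> \<le> ereal_of_enat (covering_number r (cball x R \<inter> G))"
      using y(2) by simp
    finally show ?thesis .
  next
    case False
    have ratio: "1 \<le> R / r" "R / r \<le> 4"
      using False rR by (simp_all add: field_simps)
    have "(R / r) powr \<alpha> \<le> (R / r) powr \<bar>\<alpha>\<bar>"
      using ratio by (intro powr_mono) auto
    also have "\<dots> \<le> 4 powr \<bar>\<alpha>\<bar>"
      using ratio by (intro powr_mono2) auto
    finally have "C' * (R / r) powr \<alpha> \<le> 4 powr - \<bar>\<alpha>\<bar> * 4 powr \<bar>\<alpha>\<bar>"
      using \<open>0 < C'\<close> by (intro mult_mono) (auto simp: C'_def)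
    then have "ereal (C' * (R / r) powr \<alpha>) \<le> ereal_of_enat 1"
      by (simp add: powr_minus one_enat_def)
    also have "\<dots> \<le> ereal_of_enat (covering_number r (cball x R \<inter> G))"
    proof -
      have "x \<in> cball x R \<inter> G" using rR by simp
      then have "1 \<le> covering_number r (cball x R \<inter> G)"
        by (intro covering_number_ge_1) blast
      then show ?thesis by (simp only: ereal_of_enat_le_iff)
    qed
    finally show ?thesis .
  qed
  then show "\<exists>C>0. \<exists>\<rho>>0. \<forall>r R. 0 < r \<and> r < R \<and> R \<le> \<rho> \<longrightarrow>
    ereal (C * (R / r) powr \<alpha>) \<le> ereal_of_enat (INF x\<in>G. covering_number r (cball x R \<inter> G))"
    unfolding le_ereal_of_enat_INF_iff using \<open>0 < C'\<close> \<open>0 < \<rho>\<close> by blast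
qed

theorem theorem2p3:
  fixes F :: "'a::metric_space set"
  assumes "F \<noteq> {}"
  shows "lower_dim F = lower_dim (closure F)"
proof (rule antisym)
  show "lower_dim F \<le> lower_dim (closure F)"
  proof (rule lower_dim_le_of_covering_comparison)
    fix x :: 'a and r R :: real
    assume "x \<in> closure F" "0 < r" "0 < R"
    then obtain y where y: "y \<in> F" "dist y x < R / 2"
      using closure_approachable[of x F] half_gt_zero[of R] by blast
    have "cball y (R / 2) \<subseteq> cball x R"
    proof
      fix z assume "z \<in> cball y (R / 2)"
      then show "z \<in> cball x R"
        using y(2) dist_triangle[of x z y] by (simp add: dist_commute)
    qed
    with \<open>0 < r\<close> have "covering_number (2 * r) (cball y (R / 2) \<inter> F)
        \<le> covering_number r (cball x R \<inter> closure F)"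
      using closure_subset[of F] by (intro covering_number_mono) auto
    with y(1) show "\<exists>y\<in>F. covering_number (2 * r) (cball y (R / 2) \<inter> F)
        \<le> covering_number r (cball x R \<inter> closure F)"
      by blast
  qed
next
  show "lower_dim (closure F) \<le> lower_dim F"
    by (rule lower_dim_le_of_covering_comparison)
      (use closure_subset[of F] covering_number_half_ball_closure_le in blast)
qed

end
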